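(* Let $q=[a,b,c]$ be a primitive integral form of non-square discriminant $D>0$ with $a>0>c$, and let $w$ be the river sequence word read starting from $q$, with $M$ the corresponding product of the matrices $L$ and $R$ (in the order of the word), so that $q|M=q$. If $w=X\cdot\overline{X}$ for a word $X$, where $\overline X$ is obtained from $X$ by switching every $L$ and $R$, then $q|X=-q^*$ (where $X$ also denotes the corresponding matrix product), and writing $X=\begin{pmatrix}\alpha&\beta\\\gamma&\delta\end{pmatrix}$, the minimal positive integer solution $(t_*,u_* )$ of $t^2-Du^2=-4$ is $t_*=\beta+\gamma$, $u_*=\gcd(\delta,\gamma-\beta,\alpha)$. If $w$ is not of the form $X\cdot\overline X$, then $q\not\sim-q^*$ and $t^2-Du^2=-4$ has no integer solutions.
   Context: Forms $[a,b,c]=ax^2+bxy+cy^2$ have integer coefficients, discriminant $b^2-4ac$; primitive means $\gcd(a,b,c)=1$. For $M=\begin{pmatrix}\alpha&\beta\\\gamma&\delta\end{pmatrix}$, $q|M(x,y)=q(\alpha x+\beta y,\gamma x+\delta y)$; $q_1\sim q_2$ if $q_1=q_2|M$ for some $M\in\mathrm{SL}(2,\mathbb Z)$. For $q=[a,b,c]$, $q^*:=[c,b,a]$. $L=\begin{pmatrix}1&1\\0&1\end{pmatrix}$, $R=\begin{pmatrix}1&0\\1&1\end{pmatrix}$, so $q|L=[a,b+2a,a+b+c]$ and $q|R=[a+b+c,b+2c,c]$. River sequence from a form $q$ with $a>0>c$: set $q_0=q$; for $q_j=[a_j,b_j,c_j]$, if $a_j+b_j+c_j<0$ record $L$ and set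 $q_{j+1}=q_j|L$, if $a_j+b_j+c_j>0$ record $R$ and set $q_{j+1}=q_j|R$; stop at the first $j\ge1$ with $q_j=q$. The recorded word is $w$ (this is the sequence of left/right turns along the river of the topograph of $q$ over one period). *)

theory Defs
  imports "HOL-Analysis.Analysis"
begin

section \<open>Integral binary quadratic forms\<close>

text \<open>\<open>BQF a b c\<close> is the form \<open>[a,b,c] = a x\<^sup>2 + b x y + c y\<^sup>2\<close>.\<close>

datatype bqf = BQF int int int

fun eval_form :: "bqf \<Rightarrow> int \<Rightarrow> int \<Rightarrow> int" where
  "eval_form (BQF a b c) x y = a * x\<^sup>2 + b * x * y + c * y\<^sup>2"

fun disc :: "bqf \<Rightarrow> int" where
  "disc (BQF a b c) = b\<^sup>2 - 4 * a * c"

fun primitive_form :: "bqf \<Rightarrow> bool" where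
  "primitive_form (BQF a b c) \<longleftrightarrow> Gcd {a, b, c} = 1"

fun star :: "bqf \<Rightarrow> bqf" where
  "star (BQF a b c) = BQF c b a"

fun neg_form :: "bqf \<Rightarrow> bqf" where
  "neg_form (BQF a b c) = BQF (- a) (- b) (- c)"

text \<open>The form \<open>q|M\<close>, given by the coefficients of
  \<open>q(\<alpha> x + \<beta> y, \<gamma> x + \<delta> y)\<close>; see \<open>eval_form_act\<close> below.\<close>

fun act :: "bqf \<Rightarrow> int^2^2 \<Rightarrow> bqf" where
  "act (BQF a b c) M =
     (let \<alpha> = M $ 1 $ 1; \<beta> = M $ 1 $ 2; \<gamma> = M $ 2 $ 1; \<delta> = M $ 2 $ 2
      in BQF (a * \<alpha>\<^sup>2 + b * \<alpha> * \<gamma> + c * \<gamma>\<^sup>2)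
             (2 * a * \<alpha> * \<beta> + b * (\<alpha> * \<delta> + \<beta> * \<gamma>) + 2 * c * \<gamma> * \<delta>)
             (a * \<beta>\<^sup>2 + b * \<beta> * \<delta> + c * \<delta>\<^sup>2))"

lemma eval_form_act:
  "eval_form (act q M) x y =
     eval_form q (M $ 1 $ 1 * x + M $ 1 $ 2 * y) (M $ 2 $ 1 * x + M $ 2 $ 2 * y)"
  by (cases q) (simp add: Let_def power2_eq_square algebra_simps)

definition sl_equiv :: "bqf \<Rightarrow> bqf \<Rightarrow> bool" where
  "sl_equiv q1 q2 \<longleftrightarrow> (\<exists>M :: int^2^2. det M = 1 \<and> q1 = act q2 M)"

section \<open>Words in L and R\<close>

datatype turn = L | R

fun switch :: "turn \<Rightarrow> turn" where
  "switch L = R"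
| "switch R = L"

fun turn_mat :: "turn \<Rightarrow> int^2^2" where
  "turn_mat L = vector [vector [1, 1], vector [0, 1]]"
| "turn_mat R = vector [vector [1, 0], vector [1, 1]]"

definition word_mat :: "turn list \<Rightarrow> int^2^2" where
  "word_mat w = foldr (\<lambda>s A. turn_mat s ** A) w (mat 1)"

lemma act_L: "act (BQF a b c) (turn_mat L) = BQF a (b + 2 * a) (a + b + c)"
  by simp

lemma act_R: "act (BQF a b c) (turn_mat R) = BQF (a + b + c) (b + 2 * c) c"
  by simp

section \<open>The river sequence\<close>

text \<open>The case \<open>a + b + c = 0\<close> never arises for non-square discriminant: it would give
  \<open>disc = (a - c)\<^sup>2\<close>.\<close>

fun next_turn :: "bqf \<Rightarrow> turn" where
  "next_turn (BQF a b c) = (if a + b + c < 0 then L else R)"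

fun river :: "bqf \<Rightarrow> nat \<Rightarrow> bqf" where
  "river q 0 = q"
| "river q (Suc j) = act (river q j) (turn_mat (next_turn (river q j)))"

text \<open>The least element below is meaningful only if the river returns to \<open>q\<close>.\<close>

definition river_period :: "bqf \<Rightarrow> nat" where
  "river_period q = (LEAST j. 1 \<le> j \<and> river q j = q)"

definition river_word :: "bqf \<Rightarrow> turn list" where
  "river_word q = map (\<lambda>j. next_turn (river q j)) [0..<river_period q]"

section \<open>The negative Pell-type equation\<close>

definition neg_pell :: "int \<Rightarrow> int \<Rightarrow> int \<Rightarrow> bool" where
  "neg_pell D t u \<longleftrightarrow> t\<^sup>2 - D * u\<^sup>2 = -4"

definition min_pos_neg_pell :: "int \<Rightarrow> int \<Rightarrow> int \<Rightarrow> bool" where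
  "min_pos_neg_pell D t u \<longleftrightarrow>
     0 < t \<and> 0 < u \<and> neg_pell D t u \<and>
     (\<forall>t' u'. 0 < t' \<and> 0 < u' \<and> neg_pell D t' u' \<longrightarrow> t \<le> t' \<and> u \<le> u')"

end

theory Submission
  imports Defs
begin

text \<open>Let \<open>q' = -q\<^sup>*\<close>. Matrices \<open>A\<close> of determinant \<open>1\<close> with \<open>q|A = q'\<close> correspond, via
  exchanging the columns of \<open>A\<close>, to matrices \<open>N\<close> of determinant \<open>-1\<close> with \<open>q|N = -q\<close>, and these
  are exactly the matrices with rows \<open>((t - bu)/2, -cu)\<close> and \<open>(au, (t + bu)/2)\<close> where
  \<open>t\<^sup>2 - Du\<^sup>2 = -4\<close>. If \<open>t, u > 0\<close>, then \<open>A\<close> has nonnegative entries, so it is a product of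
  \<open>L\<close>'s and \<open>R\<close>'s, and since it leads from \<open>q\<close> to a form with \<open>a > 0 > c\<close> this product is an
  initial segment of the river. Hence solutions correspond to the occurrences of \<open>q'\<close> on the river,
  and longer segments have larger matrix entries. As \<open>r \<mapsto> -r\<^sup>*\<close> maps the river to itself with
  left and right exchanged, \<open>q'\<close> can only occur at half a period; conversely, if the word is
  \<open>X\<close> followed by its switch, then the form at half a period and \<open>q'\<close> share an automorph,
  so they coincide.\<close>

section \<open>The action and its (anti-)automorphs\<close>

lemma matrix_mult_2:
  fixes A B :: "'a::semiring_1^2^2"
  shows "(A ** B) $ i $ j = A $ i $ 1 * B $ 1 $ j + A $ i $ 2 * B $ 2 $ j"
  by (simp add: matrix_matrix_mult_def sum_2)

lemma act_mult: "act (act q A) B = act q (A ** B)"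
  by (cases q) (simp add: Let_def matrix_mult_2 power2_eq_square algebra_simps)

lemma act_one [simp]: "act q (mat 1) = q"
  by (cases q) (simp add: mat_def)

lemma act_neg_form: "act (neg_form q) A = neg_form (act q A)"
  by (cases q) (simp add: Let_def algebra_simps)

definition swap_mat :: "int^2^2" where
  "swap_mat = vector [vector [0, 1], vector [1, 0]]"

lemma swap_mat_nth [simp]:
  "swap_mat $ 1 $ 1 = 0" "swap_mat $ 1 $ 2 = 1" "swap_mat $ 2 $ 1 = 1" "swap_mat $ 2 $ 2 = 0"
  by (simp_all add: swap_mat_def)

lemma det_swap_mat [simp]: "det swap_mat = -1"
  by (simp add: det_2)

lemma swap_mat_mult_self: "swap_mat ** swap_mat = mat 1"
  by (simp add: vec_eq_iff forall_2 matrix_mult_2 mat_def)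

lemma act_swap_mat: "act q swap_mat = star q"
  by (cases q) simp

text \<open>With \<open>Q\<close> the Gram matrix, \<open>N\<^sup>T Q N = e Q\<close> and \<open>det N = e\<close> give
  \<open>Q N = adj(N)\<^sup>T Q\<close>, which is linear in \<open>N\<close> and does not involve \<open>e\<close>.\<close>

lemma automorph_proportional:
  assumes "act (BQF a b c) N = BQF (e * a) (e * b) (e * c)" and "det N = e" and "e \<noteq> 0"
  shows "a * (N $ 2 $ 2 - N $ 1 $ 1) = b * N $ 2 $ 1" and "a * N $ 1 $ 2 = - c * N $ 2 $ 1"
proof -
  define x y z v where "x = N $ 1 $ 1" and "y = N $ 1 $ 2" and "z = N $ 2 $ 1" and "v = N $ 2 $ 2"
  note defs = x_def [symmetric] y_def [symmetric] z_def [symmetric] v_def [symmetric]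
  have d: "e = x * v - y * z"
    using assms(2) by (simp add: det_2 defs)
  have A: "a * x\<^sup>2 + b * x * z + c * z\<^sup>2 = e * a"
    and B: "2 * a * x * y + b * (x * v + y * z) + 2 * c * z * v = e * b"
    and C: "a * y\<^sup>2 + b * y * v + c * v\<^sup>2 = e * c"
    using assms(1) by (simp_all add: Let_def defs)
  \<comment> \<open>With \<open>e\<close> expanded as the determinant this is an identity; the
    hypotheses then make the right-hand side a multiple of \<open>e\<close>, which cancels.\<close>
  have "e * (2 * a * x + b * z) =
      2 * v * (a * x\<^sup>2 + b * x * z + c * z\<^sup>2)
        - z * (2 * a * x * y + b * (x * v + y * z) + 2 * c * z * v)"
    unfolding d by (simp add: power2_eq_square algebra_simps)
  also have "\<dots> = e * (2 * a * v - b * z)"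
    unfolding A B by (simp add: algebra_simps)
  finally have 1: "2 * a * x + b * z = 2 * a * v - b * z"
    using \<open>e \<noteq> 0\<close> by simp
  have "e * (2 * a * y + b * v) =
      v * (2 * a * x * y + b * (x * v + y * z) + 2 * c * z * v)
        - 2 * z * (a * y\<^sup>2 + b * y * v + c * v\<^sup>2)"
    unfolding d by (simp add: power2_eq_square algebra_simps)
  also have "\<dots> = e * (b * v - 2 * c * z)"
    unfolding B C by (simp add: algebra_simps)
  finally have 2: "2 * a * y + b * v = b * v - 2 * c * z"
    using \<open>e \<noteq> 0\<close> by simp
  show "a * (N $ 2 $ 2 - N $ 1 $ 1) = b * N $ 2 $ 1"
    unfolding defs using 1 by (simp add: algebra_simps)
  show "a * N $ 1 $ 2 = - c * N $ 2 $ 1"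
    unfolding defs using 2 by (simp add: algebra_simps)
qed

lemma Gcd_insert_3: "Gcd {x, y, z} = gcd x (gcd y z)"
  for x y z :: int
  by simp

text \<open>The entries \<open>N $ 2 $ 1\<close>, \<open>N $ 2 $ 2 - N $ 1 $ 1\<close>,
  \<open>- N $ 1 $ 2\<close> are proportional to \<open>a\<close>, \<open>b\<close>,
  \<open>c\<close>. Primitivity makes the factor \<open>u\<close> an integer, and the determinant
  condition becomes the Pell equation.\<close>

lemma anti_automorph:
  assumes "act (BQF a b c) N = neg_form (BQF a b c)" and "det N = -1"
    and "primitive_form (BQF a b c)" and "a \<noteq> 0"
  obtains u where "N $ 2 $ 1 = a * u" "N $ 2 $ 2 - N $ 1 $ 1 = b * u" "N $ 1 $ 2 = - c * u"
    "neg_pell (disc (BQF a b c)) (N $ 1 $ 1 + N $ 2 $ 2) u"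
proof -
  have e: "act (BQF a b c) N = BQF ((-1) * a) ((-1) * b) ((-1) * c)"
    using assms(1) by simp
  note lin = automorph_proportional [OF e assms(2)]
  have g: "gcd a (gcd b c) = 1"
    using assms(3) by (simp only: primitive_form.simps Gcd_insert_3)
  obtain x y where xy: "x * a + y * gcd b c = 1"
    using bezout_int [of a "gcd b c"] g by auto
  obtain z v where zv: "z * b + v * c = gcd b c"
    using bezout_int [of b c] by auto
  \<comment> \<open>The Bezout combination sending \<open>a\<close>, \<open>b\<close>,
    \<open>c\<close> to 1, applied to the three proportional entries, yields the factor
    itself.\<close>
  define u where "u = x * N $ 2 $ 1 + y * z * (N $ 2 $ 2 - N $ 1 $ 1) - y * v * N $ 1 $ 2"
  have "a * u = x * a * N $ 2 $ 1 + y * z * (a * (N $ 2 $ 2 - N $ 1 $ 1)) - y * v * (a * N $ 1 $ 2)"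
    unfolding u_def by (simp add: algebra_simps)
  also have "\<dots> = (x * a + y * (z * b + v * c)) * N $ 2 $ 1"
    using lin by (simp add: algebra_simps)
  finally have u1: "N $ 2 $ 1 = a * u"
    using xy zv by simp
  have "a * (N $ 2 $ 2 - N $ 1 $ 1) = a * (b * u)" "a * N $ 1 $ 2 = a * (- c * u)"
    using lin u1 by auto
  then have u2: "N $ 2 $ 2 - N $ 1 $ 1 = b * u" and u3: "N $ 1 $ 2 = - c * u"
    using \<open>a \<noteq> 0\<close> by (metis mult_left_cancel)+
  have "N $ 1 $ 1 * N $ 2 $ 2 + a * c * u\<^sup>2 = -1"
    using assms(2) u1 u3 by (simp add: det_2 power2_eq_square algebra_simps)
  moreover have "(N $ 1 $ 1 + N $ 2 $ 2)\<^sup>2 = (N $ 2 $ 2 - N $ 1 $ 1)\<^sup>2 + 4 * (N $ 1 $ 1 * N $ 2 $ 2)"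
    by (simp add: power2_eq_square algebra_simps)
  ultimately have "neg_pell (disc (BQF a b c)) (N $ 1 $ 1 + N $ 2 $ 2) u"
    unfolding neg_pell_def u2 by (simp add: power2_eq_square algebra_simps)
  then show thesis
    using that u1 u2 u3 by blast
qed

text \<open>Converse of \<open>anti_automorph\<close>: the equation forces \<open>t\<close> and
  \<open>b * u\<close> to have the same parity, so the matrix built from a solution is
  integral.\<close>

lemma neg_pell_anti_automorph:
  assumes "neg_pell (disc (BQF a b c)) t u"
  obtains N where "act (BQF a b c) N = neg_form (BQF a b c)" "det N = -1"
    "N $ 2 $ 1 = a * u" "N $ 2 $ 2 + N $ 1 $ 1 = t" "N $ 1 $ 2 = - c * u"
proof -
  have pell: "t\<^sup>2 - (b * u)\<^sup>2 + 4 * a * c * u\<^sup>2 = -4"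
    using assms by (simp add: neg_pell_def power2_eq_square algebra_simps)
  have "even (t - b * u)"
  proof -
    have "even (t\<^sup>2 - (b * u)\<^sup>2 + 4 * a * c * u\<^sup>2)"
      unfolding pell by simp
    then show ?thesis
      by simp
  qed
  then obtain x where x: "t = b * u + 2 * x"
    by (metis dvdE diff_add_cancel add.commute)
  define N :: "int^2^2" where "N = vector [vector [x, - c * u], vector [a * u, x + b * u]]"
  have N: "N $ 1 $ 1 = x" "N $ 1 $ 2 = - c * u" "N $ 2 $ 1 = a * u" "N $ 2 $ 2 = x + b * u"
    by (simp_all add: N_def)
  have d: "x * (x + b * u) + a * c * u\<^sup>2 = -1"
    using pell unfolding x by (simp add: power2_eq_square algebra_simps)
  have dd: "det N = -1"
    using d by (simp add: det_2 N power2_eq_square algebra_simps)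
  \<comment> \<open>The common factor on the right is the determinant of \<open>N\<close>, that is
    -1.\<close>
  have "a * x\<^sup>2 + b * x * (a * u) + c * (a * u)\<^sup>2 = a * (x * (x + b * u) + a * c * u\<^sup>2)"
    "2 * a * x * (- c * u) + b * (x * (x + b * u) + (- c * u) * (a * u)) + 2 * c * (a * u) * (x + b * u)
      = b * (x * (x + b * u) + a * c * u\<^sup>2)"
    "a * (- c * u)\<^sup>2 + b * (- c * u) * (x + b * u) + c * (x + b * u)\<^sup>2
      = c * (x * (x + b * u) + a * c * u\<^sup>2)"
    by (simp_all add: power2_eq_square algebra_simps)
  then have "act (BQF a b c) N = neg_form (BQF a b c)"
    unfolding d by (simp add: Let_def N)
  then show thesis
    using that [of N] dd N x by simp
qed

section \<open>Words and nonnegative matrices\<close>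

lemma turn_mat_nth [simp]:
  "turn_mat s $ 1 $ 1 = 1" "turn_mat s $ 2 $ 2 = 1"
  "turn_mat s $ 1 $ 2 = (if s = L then 1 else 0)"
  "turn_mat s $ 2 $ 1 = (if s = R then 1 else 0)"
  by (cases s; simp)+

lemma det_turn_mat: "det (turn_mat s) = 1"
  by (cases s) (simp_all add: det_2)

lemma word_mat_Nil [simp]: "word_mat [] = mat 1"
  by (simp add: word_mat_def)

lemma word_mat_Cons: "word_mat (s # w) = turn_mat s ** word_mat w"
  by (simp add: word_mat_def)

lemma word_mat_append: "word_mat (v @ w) = word_mat v ** word_mat w"
  by (induction v) (simp_all add: word_mat_Cons matrix_mul_assoc)

lemma det_word_mat: "det (word_mat w) = 1"
proof (induction w)
  case (Cons s w)
  then show ?case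
    by (simp add: word_mat_Cons det_mul det_turn_mat)
qed simp

lemma word_mat_nonneg: "0 \<le> word_mat w $ i $ j"
  using exhaust_2 [of i] exhaust_2 [of j]
  by (induction w arbitrary: i j) (auto simp: word_mat_Cons matrix_mult_2 mat_def)

text \<open>Each letter adds one row to the other, and determinant 1 forbids a zero row. Hence only
  the empty word has the identity as its matrix.\<close>

lemma length_le_word_mat_sum:
  "int (length w) + 2 \<le>
     word_mat w $ 1 $ 1 + word_mat w $ 1 $ 2 + word_mat w $ 2 $ 1 + word_mat w $ 2 $ 2"
proof (induction w)
  case (Cons s w)
  have d: "word_mat w $ 1 $ 1 * word_mat w $ 2 $ 2 - word_mat w $ 1 $ 2 * word_mat w $ 2 $ 1 = 1"
    using det_word_mat [of w] by (simp add: det_2)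
  have "0 < word_mat w $ i $ 1 + word_mat w $ i $ 2" for i
  proof (rule ccontr)
    assume "\<not> ?thesis"
    then have "word_mat w $ i $ 1 = 0" "word_mat w $ i $ 2 = 0"
      using word_mat_nonneg [of w i 1] word_mat_nonneg [of w i 2] by linarith+
    then show False
      using d exhaust_2 [of i] by auto
  qed
  from this [of 1] this [of 2] Cons show ?case
    by (cases s) (simp_all add: word_mat_Cons matrix_mult_2)
qed (simp add: mat_def)

text \<open>Appending a letter adds one nonnegative column to the other. Minimality of the Pell
  solution rests on this.\<close>

lemma word_mat_le_append: "word_mat v $ i $ j \<le> word_mat (v @ w) $ i $ j"
proof (induction w rule: rev_induct)
  case (snoc s w)
  have "word_mat (v @ w) $ i $ j \<le> (word_mat (v @ w) ** turn_mat s) $ i $ j"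
    using exhaust_2 [of j] word_mat_nonneg [of "v @ w" i] by (auto simp: matrix_mult_2)
  also have "\<dots> = word_mat (v @ w @ [s]) $ i $ j"
    by (simp add: word_mat_append word_mat_Cons matrix_mul_assoc)
  finally show ?case
    using snoc by linarith
qed simp

text \<open>Euclid's algorithm on the rows: unless the matrix is the identity, one row dominates the
  other entrywise, and subtracting the smaller row lowers the sum of the entries.\<close>

lemma nonneg_matrix_is_word_mat:
  fixes A :: "int^2^2"
  assumes "\<And>i j. 0 \<le> A $ i $ j" and "det A = 1"
  shows "\<exists>w. A = word_mat w"
  using assms
proof (induction "nat (A $ 1 $ 1 + A $ 1 $ 2 + A $ 2 $ 1 + A $ 2 $ 2)" arbitrary: A
    rule: less_induct)
  case less
  define x y z v where "x = A $ 1 $ 1" and "y = A $ 1 $ 2" and "z = A $ 2 $ 1" and "v = A $ 2 $ 2"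
  note defs = x_def [symmetric] y_def [symmetric] z_def [symmetric] v_def [symmetric]
  have nn: "0 \<le> x" "0 \<le> y" "0 \<le> z" "0 \<le> v"
    using less.prems(1) unfolding x_def y_def z_def v_def by blast+
  have d: "x * v - y * z = 1"
    using less.prems(2) by (simp add: det_2 defs)
  have pos: "0 < x + y" "0 < z + v"
    using nn d by (auto simp: less_le add_nonneg_eq_0_iff)
  have rec: "\<exists>w. A = word_mat w"
    if B: "A = turn_mat s ** B" "\<And>i j. 0 \<le> B $ i $ j"
      "B $ 1 $ 1 + B $ 1 $ 2 + B $ 2 $ 1 + B $ 2 $ 2 < x + y + z + v" for s and B :: "int^2^2"
  proof -
    have "det B = 1"
      using less.prems(2) unfolding B(1) by (simp add: det_mul det_turn_mat)
    moreover have "nat (B $ 1 $ 1 + B $ 1 $ 2 + B $ 2 $ 1 + B $ 2 $ 2)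
        < nat (A $ 1 $ 1 + A $ 1 $ 2 + A $ 2 $ 1 + A $ 2 $ 2)"
      unfolding defs using B(3) nn pos by linarith
    ultimately obtain w where "B = word_mat w"
      using less.hyps [of B] B(2) by blast
    then show ?thesis
      using B(1) word_mat_Cons by metis
  qed
  \<comment> \<open>In the last two cases no row dominates: the third leaves only the identity, the
    fourth contradicts determinant 1.\<close>
  consider "z \<le> x" "v \<le> y" | "x \<le> z" "y \<le> v" | "z < x" "y < v" | "x < z" "v < y"
    by linarith
  then show ?case
  proof cases
    case 1
    define B :: "int^2^2" where "B = vector [vector [x - z, y - v], vector [z, v]]"
    show ?thesis
    proof (rule rec [of L B])
      show "A = turn_mat L ** B"
        by (simp add: vec_eq_iff forall_2 matrix_mult_2 B_def defs del: turn_mat.simps)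
      show "0 \<le> B $ i $ j" for i j
        using 1 nn exhaust_2 [of i] exhaust_2 [of j] by (auto simp: B_def)
    qed (use pos in \<open>simp add: B_def\<close>)
  next
    case 2
    define B :: "int^2^2" where "B = vector [vector [x, y], vector [z - x, v - y]]"
    show ?thesis
    proof (rule rec [of R B])
      show "A = turn_mat R ** B"
        by (simp add: vec_eq_iff forall_2 matrix_mult_2 B_def defs del: turn_mat.simps)
      show "0 \<le> B $ i $ j" for i j
        using 2 nn exhaust_2 [of i] exhaust_2 [of j] by (auto simp: B_def)
    qed (use pos in \<open>simp add: B_def\<close>)
  next
    case 3
    \<comment> \<open>Together with \<open>x * v = 1 + y * z\<close> this leaves
      \<open>y + z \<le> 0\<close>.\<close>
    have "(z + 1) * (y + 1) \<le> x * v"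
      using 3 nn by (intro mult_mono) auto
    then have zy: "z = 0" "y = 0"
      using d nn by (auto simp: algebra_simps)
    then have "x = 1" "v = 1"
      using d nn by (auto simp: zmult_eq_1_iff)
    then have "A = word_mat []"
      using zy by (simp add: vec_eq_iff forall_2 mat_def defs)
    then show ?thesis ..
  next
    case 4
    then have "x * v \<le> z * y"
      using nn by (intro mult_mono) auto
    then show ?thesis
      using d by (simp add: mult.commute)
  qed
qed

section \<open>Forms on the river\<close>

definition river_forms :: "int \<Rightarrow> bqf set" where
  "river_forms D = {BQF a b c | a b c. 0 < a \<and> c < 0 \<and> disc (BQF a b c) = D}"

lemma BQF_in_river_forms [simp]:
  "BQF a b c \<in> river_forms D \<longleftrightarrow> 0 < a \<and> c < 0 \<and> b\<^sup>2 - 4 * a * c = D"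
  by (auto simp: river_forms_def)

text \<open>Opposite signs of \<open>a\<close> and \<open>c\<close> make
  \<open>D = b\<^sup>2 + 4 * a * (- c)\<close> a sum of nonnegative terms, which bounds every
  coefficient by \<open>D\<close>.\<close>

lemma finite_river_forms: "finite (river_forms D)"
proof (rule finite_subset)
  show "river_forms D \<subseteq> (\<lambda>(a, b, c). BQF a b c) ` ({0..D} \<times> {-D..D} \<times> {-D..0})"
  proof
    fix q assume q: "q \<in> river_forms D"
    obtain a b c where [simp]: "q = BQF a b c"
      by (cases q)
    have *: "0 < a" "0 < - c" "b\<^sup>2 + 4 * (a * - c) = D"
      using q by auto
    have "a * 1 \<le> a * - c" "1 * - c \<le> a * - c" "0 \<le> b\<^sup>2"
      using * by (intro mult_mono; simp)+ simp
    moreover have "\<bar>b\<bar> \<le> b\<^sup>2"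
    proof (cases "b = 0")
      case False
      then have "\<bar>b\<bar> * 1 \<le> \<bar>b\<bar> * \<bar>b\<bar>"
        by (intro mult_left_mono) auto
      then show ?thesis
        by (simp add: power2_eq_square)
    qed simp
    moreover have "0 \<le> a * - c"
      using * by (simp add: mult_nonneg_nonpos)
    ultimately have "a \<in> {0..D}" "b \<in> {-D..D}" "c \<in> {-D..0}"
      using * unfolding atLeastAtMost_iff mult_1_left mult_1_right by linarith+
    then show "q \<in> (\<lambda>(a, b, c). BQF a b c) ` ({0..D} \<times> {-D..D} \<times> {-D..0})"
      by force
  qed
qed simp

lemma river_forms_sum_neq_0:
  assumes "\<nexists>k :: int. D = k\<^sup>2" and "BQF a b c \<in> river_forms D"
  shows "a + b + c \<noteq> 0"
proof
  assume "a + b + c = 0"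
  then have b: "b = - a - c"
    by simp
  have "D = b\<^sup>2 - 4 * a * c"
    using assms(2) by simp
  then have "D = (a - c)\<^sup>2"
    unfolding b by (simp add: power2_eq_square algebra_simps)
  then show False
    using assms(1) by blast
qed

section \<open>Periodicity of the river\<close>

definition river_step :: "bqf \<Rightarrow> bqf" where
  "river_step q = act q (turn_mat (next_turn q))"

lemma river_step_in_river_forms:
  assumes "\<nexists>k :: int. D = k\<^sup>2" and "q \<in> river_forms D"
  shows "river_step q \<in> river_forms D"
proof -
  obtain a b c where [simp]: "q = BQF a b c"
    by (cases q)
  show ?thesis
    using assms(2) river_forms_sum_neq_0 [OF assms(1), of a b c]
    by (auto simp: river_step_def Let_def power2_eq_square algebra_simps)
qed

text \<open>The last turn can be recovered from the image: its value at (1, -1) is the old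
  \<open>c < 0\<close> after \<open>L\<close> and the old \<open>a > 0\<close> after
  \<open>R\<close>. Each single turn is invertible.\<close>

lemma inj_on_river_step:
  assumes "\<nexists>k :: int. D = k\<^sup>2"
  shows "inj_on river_step (river_forms D)"
proof (rule inj_onI)
  fix q q' assume q: "q \<in> river_forms D" "q' \<in> river_forms D" "river_step q = river_step q'"
  obtain a b c a' b' c' where [simp]: "q = BQF a b c" "q' = BQF a' b' c'"
    by (cases q, cases q')
  show "q = q'"
    using q by (auto simp: river_step_def Let_def split: if_splits)
qed

lemma river_Suc: "river q (Suc n) = river_step (river q n)"
  by (simp add: river_step_def)

lemma river_add: "river q (m + n) = river (river q m) n"
  by (induction n) (simp_all add: river_Suc del: river.simps(2))

lemma river_in_river_forms:
  assumes "\<nexists>k :: int. D = k\<^sup>2" and "q \<in> river_forms D"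
  shows "river q n \<in> river_forms D"
  by (induction n) (use assms in \<open>auto simp: river_Suc river_step_in_river_forms simp del: river.simps(2)\<close>)

text \<open>Injectivity pulls a coincidence back to the start, so the river has no
  preperiod.\<close>

lemma river_eq_imp_return:
  assumes "\<nexists>k :: int. D = k\<^sup>2" and "q \<in> river_forms D"
  shows "river q (m + n) = river q n \<Longrightarrow> river q m = q"
proof (induction n)
  case (Suc n)
  then have "river_step (river q (m + n)) = river_step (river q n)"
    by (simp add: river_Suc del: river.simps(2))
  then have "river q (m + n) = river q n"
    using inj_on_river_step [OF assms(1)] river_in_river_forms [OF assms] by (meson inj_onD)
  then show ?case
    by (rule Suc.IH)
qed simp

lemma river_returns:
  assumes "\<nexists>k :: int. D = k\<^sup>2" and "q \<in> river_forms D"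
  shows "\<exists>j\<ge>1. river q j = q"
proof -
  have "\<not> inj (river q)"
    using finite_imageD [of "river q" UNIV] river_in_river_forms [OF assms]
      finite_subset [OF _ finite_river_forms [of D]] by (metis image_subsetI infinite_UNIV_nat)
  then obtain i j where ij: "i < j" "river q i = river q j"
    unfolding inj_def by (metis linorder_neqE_nat)
  then have "river q (j - i + i) = river q i"
    by simp
  then have "river q (j - i) = q"
    by (rule river_eq_imp_return [OF assms])
  with ij show ?thesis
    by (intro exI [of _ "j - i"]) auto
qed

lemma river_period:
  assumes "\<nexists>k :: int. D = k\<^sup>2" and "q \<in> river_forms D"
  shows "1 \<le> river_period q" and "river q (river_period q) = q"
  using LeastI_ex [OF river_returns [OF assms]] by (simp_all add: river_period_def)

lemma river_period_le: "1 \<le> j \<Longrightarrow> river q j = q \<Longrightarrow> river_period q \<le> j"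
  unfolding river_period_def by (rule Least_le) simp

lemma river_mod_period:
  assumes "river q p = q"
  shows "river q (n mod p) = river q n"
proof -
  have "river q (k * p) = q" for k
    by (induction k) (simp_all add: river_add assms)
  then have "river q (n div p * p + n mod p) = river q (n mod p)"
    by (simp only: river_add)
  then show ?thesis
    by simp
qed

section \<open>Words read off the river and their uniqueness\<close>

definition turns :: "bqf \<Rightarrow> nat \<Rightarrow> turn list" where
  "turns q n = map (\<lambda>j. next_turn (river q j)) [0..<n]"

lemma turns_0 [simp]: "turns q 0 = []"
  by (simp add: turns_def)

lemma length_turns [simp]: "length (turns q n) = n"
  by (simp add: turns_def)

lemma turns_Suc: "turns q (Suc n) = turns q n @ [next_turn (river q n)]"
  by (simp add: turns_def)

lemma turns_add: "turns q (m + n) = turns q m @ turns (river q m) n"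
  by (induction n) (simp_all add: turns_Suc river_add)

lemma turns_1: "turns q (Suc 0) = [next_turn q]"
  by (simp add: turns_def)

lemma river_1: "river q (Suc 0) = river_step q"
  by (simp add: river_step_def)

lemma act_turns: "act q (word_mat (turns q n)) = river q n"
  by (induction n)
    (simp_all add: turns_Suc word_mat_append word_mat_Cons act_mult [symmetric])

lemma act_pos:
  assumes "0 < a" "0 < b" "0 < c" and "act (BQF a b c) (word_mat w) = BQF a' b' c'"
  shows "0 < a' \<and> 0 < b' \<and> 0 < c'"
  using assms
proof (induction w arbitrary: a b c)
  case (Cons s w)
  have *: "act (act (BQF a b c) (turn_mat s)) (word_mat w) = BQF a' b' c'"
    using Cons.prems(4) by (simp only: word_mat_Cons act_mult)
  show ?case
  proof (cases s)
    case L
    with * show ?thesis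
      using Cons.IH [of a "b + 2 * a" "a + b + c"] Cons.prems(1-3) by (simp add: act_L del: act.simps turn_mat.simps)
  next
    case R
    with * show ?thesis
      using Cons.IH [of "a + b + c" "b + 2 * c" c] Cons.prems(1-3) by (simp add: act_R del: act.simps turn_mat.simps)
  qed
qed auto

lemma act_neg:
  assumes "a < 0" "b < 0" "c < 0" and "act (BQF a b c) (word_mat w) = BQF a' b' c'"
  shows "a' < 0 \<and> b' < 0 \<and> c' < 0"
  using act_pos [of "- a" "- b" "- c" w "- a'" "- b'" "- c'"] act_neg_form [of "BQF a b c" "word_mat w"]
    assms by simp

text \<open>A wrong turn makes all coefficients have the same sign, and no further turns can undo
  this.\<close>

lemma word_to_river_form:
  assumes "\<nexists>k :: int. D = k\<^sup>2" and "q \<in> river_forms D" and "act q (word_mat w) \<in> river_forms D"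
  shows "w = turns q (length w)"
  using assms(2,3)
proof (induction w arbitrary: q)
  case (Cons s w)
  obtain a b c where q [simp]: "q = BQF a b c"
    by (cases q)
  obtain a' b' c' where q': "act q (word_mat (s # w)) = BQF a' b' c'"
    using bqf.exhaust by blast
  have a': "0 < a'" "c' < 0"
    using Cons.prems(2) unfolding q' by simp_all
  have ac: "0 < a" "c < 0" "a + b + c \<noteq> 0"
    using Cons.prems(1) river_forms_sum_neq_0 [OF assms(1), of a b c] by auto
  have r: "act (act q (turn_mat s)) (word_mat w) = BQF a' b' c'"
    using q' by (simp only: word_mat_Cons act_mult)
  have s: "s = next_turn q"
  proof (cases s)
    case L
    then have *: "act (BQF a (b + 2 * a) (a + b + c)) (word_mat w) = BQF a' b' c'"
      using r by (simp only: q act_L)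
    \<comment> \<open>If \<open>a + b + c > 0\<close>, then \<open>b + 2 * a > a - c > 0\<close>, so
      all three coefficients would be positive and stay so. The case of \<open>R\<close> is the
      mirror image.\<close>
    have "\<not> 0 < a + b + c"
      using act_pos [OF _ _ _ *] ac a' by auto
    then show ?thesis
      using ac L by simp
  next
    case R
    then have *: "act (BQF (a + b + c) (b + 2 * c) c) (word_mat w) = BQF a' b' c'"
      using r by (simp only: q act_R)
    have "\<not> a + b + c < 0"
      using act_neg [OF _ _ _ *] ac a' by auto
    then show ?thesis
      using ac R by simp
  qed
  have "act (river_step q) (word_mat w) \<in> river_forms D"
    using Cons.prems(2) s by (simp only: word_mat_Cons act_mult river_step_def)
  then have "w = turns (river_step q) (length w)"
    using Cons.IH river_step_in_river_forms [OF assms(1) Cons.prems(1)] by blast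
  then show ?case
    using turns_add [of q "Suc 0" "length w"] s by (simp add: turns_1 river_1 del: river.simps(2))
qed simp

text \<open>A nontrivial automorph determines its form up to a scalar; equal discriminants and
  \<open>a, a' > 0\<close> make the scalar 1.\<close>

lemma river_eq_of_common_automorph:
  assumes "q \<in> river_forms D" "q' \<in> river_forms D" "D \<noteq> 0" and "w \<noteq> []"
    and "act q (word_mat w) = q" "act q' (word_mat w) = q'"
  shows "q = q'"
proof -
  obtain a b c a' b' c' where [simp]: "q = BQF a b c" "q' = BQF a' b' c'"
    by (cases q, cases q')
  define x y z v where "x = word_mat w $ 1 $ 1" and "y = word_mat w $ 1 $ 2"
    and "z = word_mat w $ 2 $ 1" and "v = word_mat w $ 2 $ 2"
  note defs = x_def [symmetric] y_def [symmetric] z_def [symmetric] v_def [symmetric]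
  have ac: "0 < a" "0 < a'" "b\<^sup>2 - 4 * a * c = D" "b'\<^sup>2 - 4 * a' * c' = D"
    using assms(1,2) by auto
  have lin: "a * (v - x) = b * z" "a * y = - c * z" "a' * (v - x) = b' * z" "a' * y = - c' * z"
    using automorph_proportional [of a b c "word_mat w" 1]
      automorph_proportional [of a' b' c' "word_mat w" 1] assms(5,6)
    by (simp_all add: defs det_word_mat del: act.simps)
  \<comment> \<open>Otherwise the matrix is the identity, with entry sum 2, while a nonempty word
    gives at least 3.\<close>
  have "z \<noteq> 0"
  proof
    assume "z = 0"
    with lin ac have "y = 0"
      by simp
    have "x * v - y * z = 1"
      using det_word_mat [of w] by (simp add: det_2 defs)
    then have "x = 1" "v = 1"
      using \<open>z = 0\<close> word_mat_nonneg [of w 1 1] by (auto simp: zmult_eq_1_iff defs)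
    then show False
      using length_le_word_mat_sum [of w] \<open>z = 0\<close> \<open>y = 0\<close> \<open>w \<noteq> []\<close> by (simp add: defs)
  qed
  have "z * (a * b') = z * (a' * b)" "z * (a * c') = z * (a' * c)"
    using lin by algebra+
  then have ratio: "a * b' = a' * b" "a * c' = a' * c"
    using \<open>z \<noteq> 0\<close> by simp_all
  have "a\<^sup>2 * D = (a * b')\<^sup>2 - 4 * a * a' * (a * c')"
    unfolding ac(4) [symmetric] by (simp add: power2_eq_square algebra_simps)
  also have "\<dots> = a'\<^sup>2 * D"
    unfolding ratio ac(3) [symmetric] by (simp add: power2_eq_square algebra_simps)
  finally have "a = a'"
    using \<open>D \<noteq> 0\<close> ac by simp
  then show ?thesis
    using ratio ac by simp
qed

section \<open>The symmetry of the river\<close>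

lemma flip_in_river_forms:
  "q \<in> river_forms D \<Longrightarrow> neg_form (star q) \<in> river_forms D"
  by (cases q) (simp add: algebra_simps)

lemma flip_flip [simp]: "neg_form (star (neg_form (star q))) = q"
  by (cases q) simp

lemma switch_switch [simp]: "switch (switch s) = s"
  by (cases s) auto

text \<open>The flip negates \<open>a + b + c\<close>, which never vanishes on the river, so the
  asymmetric default in \<open>next_turn\<close> does no harm.\<close>

lemma next_turn_flip:
  assumes "\<nexists>k :: int. D = k\<^sup>2" and "q \<in> river_forms D"
  shows "next_turn (neg_form (star q)) = switch (next_turn q)"
  using river_forms_sum_neq_0 [OF assms(1)] assms(2) by (cases q) fastforce

lemma river_flip:
  assumes "\<nexists>k :: int. D = k\<^sup>2" and "q \<in> river_forms D"
  shows "river (neg_form (star q)) n = neg_form (star (river q n))"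
proof (induction n)
  case (Suc n)
  \<comment> \<open>Conjugation by \<open>swap_mat\<close> exchanges the matrices of
    \<open>L\<close> and \<open>R\<close>.\<close>
  have *: "act (neg_form (star r)) (turn_mat (switch s)) = neg_form (star (act r (turn_mat s)))" for r s
    by (cases r; cases s) (simp_all add: Let_def)
  show ?case
    using next_turn_flip [OF assms(1) river_in_river_forms [OF assms], of n] Suc * by simp
qed simp

lemma turns_flip:
  assumes "\<nexists>k :: int. D = k\<^sup>2" and "q \<in> river_forms D"
  shows "turns (neg_form (star q)) n = map switch (turns q n)"
  by (simp add: turns_def river_flip [OF assms] next_turn_flip [OF assms(1) river_in_river_forms [OF assms]])

text \<open>Translates reaching the flipped form into having an anti-automorph, where the Pell
  parametrization applies.\<close>

lemma flip_eq_act_swap_mat: "act q A = neg_form (star q) \<longleftrightarrow> act q (A ** swap_mat) = neg_form q"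
proof
  assume "act q A = neg_form (star q)"
  then show "act q (A ** swap_mat) = neg_form q"
    by (simp add: act_mult [symmetric] act_swap_mat, cases q, simp)
next
  assume "act q (A ** swap_mat) = neg_form q"
  then have "act (act q (A ** swap_mat)) swap_mat = neg_form (star q)"
    by (cases q) (simp only: act_swap_mat neg_form.simps star.simps)
  then show "act q A = neg_form (star q)"
    by (simp add: act_mult matrix_mul_assoc [symmetric] swap_mat_mult_self)
qed

section \<open>Pell solutions and the half period\<close>

lemma neg_pell_nonzero:
  assumes "\<nexists>k :: int. D = k\<^sup>2" and "neg_pell D t u"
  shows "t \<noteq> 0" and "u \<noteq> 0"
proof -
  show "u \<noteq> 0"
  proof
    assume "u = 0"
    then have "t\<^sup>2 = -4"
      using assms(2) by (simp add: neg_pell_def)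
    then show False
      using zero_le_power2 [of t] by linarith
  qed
  show "t \<noteq> 0"
  proof
    assume "t = 0"
    \<comment> \<open>Then \<open>u\<close> divides 2 and \<open>D\<close> is the square of
      \<open>2 / u\<close>.\<close>
    then have e: "D * u\<^sup>2 = 2\<^sup>2"
      using assms(2) by (simp add: neg_pell_def)
    then have "u\<^sup>2 dvd 2\<^sup>2"
      by (metis dvd_triv_right)
    then have "u dvd 2"
      using pow_divides_pow_iff [of 2 u 2] by (metis zero_less_numeral)
    then obtain k where k: "2 = u * k"
      by (elim dvdE)
    then have "u\<^sup>2 * D = u\<^sup>2 * k\<^sup>2"
      using e unfolding k by (simp add: power_mult_distrib mult.commute)
    then show False
      using assms(1) \<open>u \<noteq> 0\<close> by auto
  qed
qed

text \<open>Swapping the columns of the anti-automorph of a positive solution gives a nonnegative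
  matrix of determinant 1, hence a word, which \<open>word_to_river_form\<close> forces to follow
  the river.\<close>

lemma neg_pell_river_word:
  assumes nsq: "\<nexists>k :: int. D = k\<^sup>2" and q: "q = BQF a b c" "q \<in> river_forms D"
    and "neg_pell D t u" "0 < t" "0 < u"
  obtains k where "1 \<le> k" "river q k = neg_form (star q)"
    "word_mat (turns q k) $ 1 $ 2 + word_mat (turns q k) $ 2 $ 1 = t"
    "word_mat (turns q k) $ 2 $ 2 = a * u"
proof -
  have ac: "0 < a" "c < 0" "disc (BQF a b c) = D"
    using q by auto
  then have "neg_pell (disc (BQF a b c)) t u"
    using assms(4) by simp
  then obtain N where N: "act q N = neg_form q" "det N = -1"
    "N $ 2 $ 1 = a * u" "N $ 2 $ 2 + N $ 1 $ 1 = t" "N $ 1 $ 2 = - c * u"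
    unfolding q(1) by (rule neg_pell_anti_automorph)
  define A where "A = N ** swap_mat"
  have A: "A $ 1 $ 1 = N $ 1 $ 2" "A $ 1 $ 2 = N $ 1 $ 1" "A $ 2 $ 1 = N $ 2 $ 2" "A $ 2 $ 2 = N $ 2 $ 1"
    by (simp_all add: A_def matrix_mult_2)
  have pos: "1 \<le> A $ 1 $ 1" "1 \<le> A $ 2 $ 2"
    using ac \<open>0 < u\<close> mult_pos_pos [of "- c" u] mult_pos_pos [of a u] unfolding A N by linarith+
  have dA: "det A = 1"
    using N(2) by (simp add: A_def det_mul)
  have "1 * 1 \<le> A $ 1 $ 1 * A $ 2 $ 2"
    using pos by (intro mult_mono) auto
  \<comment> \<open>The off-diagonal entries have nonnegative product and positive sum
    \<open>t\<close>, so neither is negative.\<close>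
  then have "0 \<le> A $ 1 $ 2 * A $ 2 $ 1"
    using dA by (simp add: det_2)
  moreover have "0 < A $ 1 $ 2 + A $ 2 $ 1"
    using N(4) \<open>0 < t\<close> by (simp add: A)
  ultimately have "0 \<le> A $ 1 $ 2" "0 \<le> A $ 2 $ 1"
    by (auto simp: zero_le_mult_iff)
  then have "0 \<le> A $ i $ j" for i j
    using pos exhaust_2 [of i] exhaust_2 [of j] by auto
  then obtain w where w: "A = word_mat w"
    using nonneg_matrix_is_word_mat dA by blast
  have "N = A ** swap_mat"
    by (simp add: A_def matrix_mul_assoc [symmetric] swap_mat_mult_self)
  then have qA: "act q A = neg_form (star q)"
    using N(1) flip_eq_act_swap_mat by simp
  have wt: "w = turns q (length w)"
    using word_to_river_form [OF nsq q(2), of w] qA w flip_in_river_forms [OF q(2)] by simp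
  have "w \<noteq> []"
    using \<open>0 < A $ 1 $ 2 + A $ 2 $ 1\<close> by (auto simp: w mat_def)
  then have "1 \<le> length w"
    by (cases w) auto
  moreover have "river q (length w) = neg_form (star q)"
    using act_turns [of q "length w"] wt w qA by simp
  moreover have "word_mat (turns q (length w)) = A"
    using wt w by simp
  ultimately show thesis
    using that [of "length w"] A N by (simp add: add.commute)
qed

lemma flip_neq_self:
  assumes "\<nexists>k :: int. D = k\<^sup>2" and "q \<in> river_forms D"
  shows "neg_form (star q) \<noteq> q"
proof
  assume e: "neg_form (star q) = q"
  obtain a b c where [simp]: "q = BQF a b c"
    by (cases q)
  have "c = - a" "b = 0"
    using e by auto
  then have "D = (2 * a)\<^sup>2"
    using assms(2) by (auto simp: power2_eq_square)
  then show False
    using assms(1) by blast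
qed

text \<open>Going equally far again undoes the flip, so twice the reduced index \<open>h\<close> is
  a multiple of the period. As \<open>h\<close> is nonzero and below the period, it is exactly half
  of it.\<close>

lemma river_word_eq_of_flip:
  assumes nsq: "\<nexists>k :: int. D = k\<^sup>2" and q: "q \<in> river_forms D"
    and k: "river q k = neg_form (star q)"
  shows "\<exists>X. river_word q = X @ map switch X"
proof -
  let ?p = "river_period q"
  note p = river_period [OF nsq q]
  define h where "h = k mod ?p"
  have h: "river q h = neg_form (star q)"
    using river_mod_period [OF p(2), of k] k by (simp add: h_def)
  have "h < ?p"
    using p by (simp add: h_def)
  have "h \<noteq> 0"
    using h flip_neq_self [OF nsq q] by (metis river.simps(1))
  have "river q (h + h) = q"
    by (simp add: river_add h river_flip [OF nsq q])
  then have "river q ((h + h) mod ?p) = q"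
    using river_mod_period [OF p(2)] by simp
  then have "(h + h) mod ?p = 0"
    using river_period_le [of "(h + h) mod ?p" q] p
    by (metis One_nat_def Suc_leI leD le_less_trans mod_less_divisor neq0_conv zero_less_one order_less_le_trans)
  then obtain m where m: "h + h = ?p * m"
    by blast
  have "?p * m < ?p * 2"
    using m \<open>h < ?p\<close> by linarith
  moreover have "?p * m \<noteq> 0"
    using m \<open>h \<noteq> 0\<close> by linarith
  ultimately have "m = 1"
    by auto
  then have "river_word q = turns q (h + h)"
    using m by (simp add: river_word_def turns_def)
  also have "\<dots> = turns q h @ map switch (turns q h)"
    by (simp add: turns_add h turns_flip [OF nsq q])
  finally show ?thesis
    by blast
qed

text \<open>The form at half a period and the flipped form both read \<open>map switch X @ X\<close>
  over a full period, so they share this automorph.\<close>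

lemma river_half_period:
  assumes nsq: "\<nexists>k :: int. D = k\<^sup>2" and "D \<noteq> 0" and q: "q \<in> river_forms D"
    and X: "river_word q = X @ map switch X"
  shows "X = turns q (length X)" and "river q (length X) = neg_form (star q)"
    and "river_period q = 2 * length X" and "X \<noteq> []"
proof -
  let ?h = "length X"
  note p = river_period [OF nsq q]
  have w: "turns q (river_period q) = X @ map switch X"
    using X by (simp add: river_word_def turns_def)
  then show per: "river_period q = 2 * ?h"
    by (metis length_append length_map length_turns mult_2)
  then show "X \<noteq> []"
    using p by auto
  have *: "turns q ?h @ turns (river q ?h) ?h = X @ map switch X"
    using w turns_add [of q ?h ?h] by (simp add: per mult_2)
  then show X: "X = turns q ?h"
    by (simp add: append_eq_append_conv)
  have X': "map switch X = turns (river q ?h) ?h"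
    using * by (simp add: append_eq_append_conv)
  have qq: "river q (?h + ?h) = q"
    using p(2) by (simp add: per mult_2)
  have "river (river q ?h) (?h + ?h) = river q ?h"
    by (metis qq river_add add.commute)
  moreover have "turns (river q ?h) (?h + ?h) = map switch X @ X"
    using X X' qq by (simp add: turns_add river_add [symmetric])
  ultimately have 1: "act (river q ?h) (word_mat (map switch X @ X)) = river q ?h"
    by (metis act_turns)
  \<comment> \<open>The flip switches every letter of \<open>X @ map switch X\<close>.\<close>
  have "turns (neg_form (star q)) (?h + ?h) = map switch X @ X"
    using w by (simp add: turns_flip [OF nsq q] per mult_2 comp_def)
  moreover have "river (neg_form (star q)) (?h + ?h) = neg_form (star q)"
    by (simp add: river_flip [OF nsq q] qq)
  ultimately have 2: "act (neg_form (star q)) (word_mat (map switch X @ X)) = neg_form (star q)"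
    by (metis act_turns)
  show "river q ?h = neg_form (star q)"
    using river_eq_of_common_automorph [OF river_in_river_forms [OF nsq q] flip_in_river_forms [OF q]
        \<open>D \<noteq> 0\<close> _ 1 2] \<open>X \<noteq> []\<close> by simp
qed

theorem theorem8p14:
  fixes a b c D :: int and q :: bqf and w :: "turn list"
  assumes "q = BQF a b c"
    and "primitive_form q"
    and "D = disc q"
    and "D > 0"
    and "\<nexists>k :: int. D = k\<^sup>2"
    and "a > 0" and "0 > c"
    and "w = river_word q"
  shows "(\<exists>j\<ge>1. river q j = q) \<and>
    act q (word_mat w) = q \<and>
    (\<forall>X \<alpha> \<beta> \<gamma> \<delta>.
       w = X @ map switch X \<and> word_mat X = vector [vector [\<alpha>, \<beta>], vector [\<gamma>, \<delta>]] \<longrightarrow>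
         act q (word_mat X) = neg_form (star q) \<and>
         min_pos_neg_pell D (\<beta> + \<gamma>) (Gcd {\<delta>, \<gamma> - \<beta>, \<alpha>})) \<and>
    ((\<nexists>X. w = X @ map switch X) \<longrightarrow>
       \<not> sl_equiv q (neg_form (star q)) \<and> (\<nexists>t u. neg_pell D t u))"
proof (intro conjI allI impI)
  note nsq = assms(5)
  have q: "q \<in> river_forms D"
    using assms(1,3,6,7) by simp
  have "D \<noteq> 0" "a \<noteq> 0" and prim: "primitive_form (BQF a b c)"
    and D: "disc (BQF a b c) = D"
    using assms by auto
  show "\<exists>j\<ge>1. river q j = q"
    using river_returns [OF nsq q] .
  have "w = turns q (river_period q)"
    by (simp add: assms(8) river_word_def turns_def)
  then show "act q (word_mat w) = q"
    using act_turns river_period [OF nsq q] by simp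
  {
    fix X \<alpha> \<beta> \<gamma> \<delta>
    assume "w = X @ map switch X \<and> word_mat X = vector [vector [\<alpha>, \<beta>], vector [\<gamma>, \<delta>]]"
    then have wX: "river_word q = X @ map switch X"
      and X: "word_mat X $ 1 $ 1 = \<alpha>" "word_mat X $ 1 $ 2 = \<beta>"
        "word_mat X $ 2 $ 1 = \<gamma>" "word_mat X $ 2 $ 2 = \<delta>"
      using assms(8) by simp_all
    note half = river_half_period [OF nsq \<open>D \<noteq> 0\<close> q wX]
    show qX: "act q (word_mat X) = neg_form (star q)"
      using half(1,2) act_turns by metis
    define N where "N = word_mat X ** swap_mat"
    have N: "N $ 1 $ 1 = \<beta>" "N $ 1 $ 2 = \<alpha>" "N $ 2 $ 1 = \<delta>" "N $ 2 $ 2 = \<gamma>"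
      by (simp_all add: N_def matrix_mult_2 X)
    have "act (BQF a b c) N = neg_form (BQF a b c)"
      using qX flip_eq_act_swap_mat assms(1) N_def by metis
    moreover have "det N = -1"
      by (simp add: N_def det_mul det_word_mat)
    ultimately obtain u where u: "\<delta> = a * u" "\<gamma> - \<beta> = b * u" "\<alpha> = - c * u"
      "neg_pell D (\<beta> + \<gamma>) u"
      using anti_automorph [OF _ _ prim \<open>a \<noteq> 0\<close>, of N] unfolding N D by metis
    have nn: "0 \<le> \<alpha>" "0 \<le> \<beta>" "0 \<le> \<gamma>" "0 \<le> \<delta>"
      using word_mat_nonneg X by metis+
    have "0 \<le> u"
      using nn(4) assms(6) unfolding u(1) by (simp add: zero_le_mult_iff)
    then have pos: "0 < u" "0 < \<beta> + \<gamma>"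
      using neg_pell_nonzero [OF nsq u(4)] nn by auto
    \<comment> \<open>The entries are \<open>u\<close> times the coefficients up to sign, so
      primitivity leaves \<open>u\<close>.\<close>
    have "Gcd {\<delta>, \<gamma> - \<beta>, \<alpha>} = gcd (a * u) (gcd (b * u) (- (c * u)))"
      unfolding Gcd_insert_3 u by simp
    also have "\<dots> = gcd a (gcd b c) * u"
      using pos by (simp add: gcd_mult_right gcd.commute)
    also have "\<dots> = u"
      using prim by (simp only: primitive_form.simps Gcd_insert_3 mult_1_left)
    finally have g: "Gcd {\<delta>, \<gamma> - \<beta>, \<alpha>} = u" .
    show "min_pos_neg_pell D (\<beta> + \<gamma>) (Gcd {\<delta>, \<gamma> - \<beta>, \<alpha>})"
      unfolding min_pos_neg_pell_def g
    proof (intro conjI allI impI)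
      fix t' u' assume "0 < t' \<and> 0 < u' \<and> neg_pell D t' u'"
      then obtain k where k: "1 \<le> k" "river q k = neg_form (star q)"
        "word_mat (turns q k) $ 1 $ 2 + word_mat (turns q k) $ 2 $ 1 = t'"
        "word_mat (turns q k) $ 2 $ 2 = a * u'"
        using neg_pell_river_word [OF nsq assms(1) q] by metis
      \<comment> \<open>An earlier occurrence of the flipped form would make the river return to
        \<open>q\<close> after \<open>length X - k\<close> steps, less than a period.\<close>
      have "length X \<le> k"
      proof (rule ccontr)
        assume "\<not> ?thesis"
        then have lt: "k < length X"
          by simp
        then have "river q (length X - k + k) = river q k"
          using half(2) k(2) by simp
        then have "river q (length X - k) = q"
          by (rule river_eq_imp_return [OF nsq q])
        then show False
          using river_period_le [of "length X - k" q] lt half(3) by linarith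
      qed
      \<comment> \<open>So \<open>X\<close> begins the word of any positive solution, and both
        \<open>\<beta> + \<gamma>\<close> and \<open>\<delta> = a * u\<close> can only grow.\<close>
      then have "turns q k = X @ turns (river q (length X)) (k - length X)"
        using turns_add [of q "length X" "k - length X"] half(1) by simp
      then have le: "word_mat X $ i $ j \<le> word_mat (turns q k) $ i $ j" for i j
        by (simp add: word_mat_le_append)
      show "\<beta> + \<gamma> \<le> t'"
        using le [of 1 2] le [of 2 1] k(3) X by linarith
      show "u \<le> u'"
        using le [of 2 2] k(4) X(4) assms(6) by (simp add: u(1))
    qed (use pos u in auto)
  }
  assume nX: "\<nexists>X. w = X @ map switch X"
  show no_pell: "\<nexists>t u. neg_pell D t u"
  proof
    assume "\<exists>t u. neg_pell D t u"
    then obtain t u where tu: "neg_pell D t u"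
      by blast
    then have "neg_pell D \<bar>t\<bar> \<bar>u\<bar>" "0 < \<bar>t\<bar>" "0 < \<bar>u\<bar>"
      using neg_pell_nonzero [OF nsq tu] by (simp_all add: neg_pell_def)
    then obtain k where "river q k = neg_form (star q)"
      using neg_pell_river_word [OF nsq assms(1) q] by metis
    then show False
      using river_word_eq_of_flip [OF nsq q] nX assms(8) by blast
  qed
  show "\<not> sl_equiv q (neg_form (star q))"
  proof
    assume "sl_equiv q (neg_form (star q))"
    then obtain M :: "int^2^2" where M: "det M = 1" "q = act (neg_form (star q)) M"
      unfolding sl_equiv_def by blast
    \<comment> \<open>The equivalence thus yields an anti-automorph of determinant -1, and with it a
      Pell solution of arbitrary signs.\<close>
    have "neg_form q = act q (swap_mat ** M)"
    proof -
      have "q = neg_form (act q (swap_mat ** M))"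
        using M(2) by (simp add: act_neg_form act_mult [symmetric] act_swap_mat)
      then show ?thesis
        by (metis act_neg_form flip_flip act_swap_mat act_mult swap_mat_mult_self act_one)
    qed
    then show False
      using anti_automorph [OF _ _ prim \<open>a \<noteq> 0\<close>, of "swap_mat ** M"] M(1) no_pell D
      by (metis assms(1) det_mul det_swap_mat mult.right_neutral)
  qed
qed

end
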